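(* Let $d \geq 54000$ be an integer and let $G=(V,E)$ be a finite simple $d$-regular graph. Then $G$ is decomposable to $4$ locally irregular subgraphs; that is, the edge set can be partitioned as $E = E_1\cup E_2\cup E_3\cup E_4$ (with the $E_i$ pairwise disjoint) such that for every $i\in\{1,2,3,4\}$ the graph $G_i=(V,E_i)$ is locally irregular.
   Context: All graphs are simple and finite. A graph $G=(V,E)$ is locally irregular if adjacent vertices have distinct degrees, i.e. $d_G(u)\neq d_G(v)$ for every edge $uv\in E$, where $d_G(v)$ denotes the degree of $v$ in $G$. A graph $G=(V,E)$ is decomposable to $k$ locally irregular subgraphs if its edge set can be partitioned into $k$ subsets $E=E_1\cup E_2\cup\ldots\cup E_k$ such that the subgraph $G_i=(V,E_i)$ is locally irregular for $i=1,2,\ldots,k$. *)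

theory Defs
  imports "HOL-Library.Disjoint_Sets"
begin

definition simple_graph :: "'a set \<Rightarrow> 'a set set \<Rightarrow> bool" where
  "simple_graph V E \<longleftrightarrow> finite V \<and> (\<forall>e\<in>E. e \<subseteq> V \<and> card e = 2)"

definition graph_degree :: "'a set set \<Rightarrow> 'a \<Rightarrow> nat" where
  "graph_degree E v = card {e \<in> E. v \<in> e}"

definition regular_graph :: "nat \<Rightarrow> 'a set \<Rightarrow> 'a set set \<Rightarrow> bool" where
  "regular_graph d V E \<longleftrightarrow> simple_graph V E \<and> (\<forall>v\<in>V. graph_degree E v = d)"

definition locally_irregular :: "'a set \<Rightarrow> 'a set set \<Rightarrow> bool" where
  "locally_irregular V E \<longleftrightarrow>
     simple_graph V E \<and>
     (\<forall>u\<in>V. \<forall>v\<in>V. {u, v} \<in> E \<longrightarrow> graph_degree E u \<noteq> graph_degree E v)"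

text \<open>As usual for edge decompositions, the parts are indexed and may be empty.\<close>

definition lir_decomposable :: "nat \<Rightarrow> 'a set \<Rightarrow> 'a set set \<Rightarrow> bool" where
  "lir_decomposable k V E \<longleftrightarrow>
     (\<exists>P. disjoint_family_on P {1..k} \<and> (\<Union>i\<in>{1..k}. P i) = E \<and>
          (\<forall>i\<in>{1..k}. locally_irregular V (P i)))"

end

theory Submission
  imports Defs "HOL-Probability.Hoeffding" "HOL-Probability.Product_PMF" "HOL-Analysis.Harmonic_Numbers"
begin

text \<open>
  Split \<open>V\<close> at random into six pieces of suitable sizes. By Hoeffding's inequality and the local
  lemma, every vertex has close to the expected number of neighbours in every union of pieces.
  All edges inside a piece \<open>p\<close> get one colour, its inner colour, and the edges between two pieces get
  either a prescribed colour or one of two prescribed colours. In the latter case one of the two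
  pieces owns these edges, and one of the two colours is the inner colour of the owner.

  The sizes and colours are such that, whatever choices are made, the two ends of an edge between
  different pieces have different degrees in the colour of that edge: its possible degrees at
  one end all exceed those at the other. It remains to deal with the edges inside a piece.
  Process the vertices piece by piece; a vertex has more owned edges than neighbours in its own
  piece, so a suitable number of owned edges in the inner colour keeps its degree in that
  colour different from those of the earlier neighbours in its piece. The order of the pieces is
  such that this never changes the inner degree of a vertex processed before.
\<close>

subsection \<open>Local lemma and balanced partitions\<close>

text \<open>The classical induction of Erdos and Lovasz in the symmetric case: conditioned on
  avoiding any subfamily, an event has probability at most \<open>2 * p\<close>, and at most
  \<open>D\<close> dependent events cannot use up more than half of what is left.\<close>

lemma (in prob_space) lovasz_local:
  fixes A :: "'i \<Rightarrow> 'a set"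
  assumes I: "finite I" and A: "\<And>i. i \<in> I \<Longrightarrow> A i \<in> events"
    and indep: "\<And>i S. i \<in> I \<Longrightarrow> S \<subseteq> I - \<Gamma> i \<Longrightarrow>
      prob (A i \<inter> (space M - (\<Union>j\<in>S. A j))) = prob (A i) * prob (space M - (\<Union>j\<in>S. A j))"
    and p: "\<And>i. i \<in> I \<Longrightarrow> prob (A i) \<le> p"
    and D: "\<And>i. i \<in> I \<Longrightarrow> card (\<Gamma> i \<inter> I) \<le> D" "D > 0"
    and pD: "4 * p * real D \<le> 1"
  shows "prob (space M - (\<Union>i\<in>I. A i)) > 0"
proof -
  define N where "N S = space M - (\<Union>j\<in>S. A j)" for S
  have N_ev: "N S \<in> events" if "S \<subseteq> I" for S
    unfolding N_def using that finite_subset[OF that I] A by (intro sets.Diff sets.finite_UN) auto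
  have N_insert: "prob (N (insert i S)) = prob (N S) - prob (A i \<inter> N S)" if "i \<in> I" "S \<subseteq> I" for i S
  proof -
    have "N (insert i S) = N S - A i \<inter> N S"
      by (auto simp: N_def)
    then show ?thesis
      using that A N_ev by (simp add: finite_measure_Diff sets.Int)
  qed
  \<comment> \<open>The conditional bound is written as a product, so that the induction need not
    know that \<open>prob (N S)\<close> is positive.\<close>
  have main: "prob (A i \<inter> N S) \<le> 2 * p * prob (N S)" if "S \<subseteq> I" "i \<in> I" for S i
    using that
  proof (induction "card S" arbitrary: S i rule: less_induct)
    case less
    note [simp] = finite_subset[OF less.prems(1) I]
    have p0: "p \<ge> 0"
      using p[OF less.prems(2)] measure_nonneg[of M "A i"] by linarith
    define S1 S2 where "S1 = S \<inter> \<Gamma> i" and "S2 = S - \<Gamma> i"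
    have S2: "S2 \<subseteq> I" "S2 \<subseteq> I - \<Gamma> i" "finite S2"
      using less.prems by (auto simp: S2_def)
    have S1: "S1 \<subseteq> I" "finite S1" and S: "S = S1 \<union> S2"
      using less.prems by (auto simp: S1_def S2_def)
    have "prob (A i \<inter> N S) \<le> prob (A i \<inter> N S2)"
      using A N_ev S2 less.prems by (intro finite_measure_mono) (auto simp: N_def S)
    also have "\<dots> = prob (A i) * prob (N S2)"
      unfolding N_def by (rule indep) (use less.prems S2 in auto)
    also have "\<dots> \<le> p * prob (N S2)"
      by (intro mult_right_mono p less.prems) auto
    also have "\<dots> \<le> p * (2 * prob (N S))"
    \<comment> \<open>Passing from \<open>N S2\<close> to \<open>N S\<close> loses at most half of
      the probability: a union bound over \<open>S1\<close>, with the induction hypothesis for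
      \<open>S2\<close>, which is smaller than \<open>S\<close> as soon as \<open>S1\<close> has an
      element.\<close>
    proof (rule mult_left_mono[OF _ p0])
      have "prob (N S2) \<le> prob (N S) + prob (\<Union>j\<in>S1. A j \<inter> N S2)"
      proof -
        have "N S2 \<subseteq> N S \<union> (\<Union>j\<in>S1. A j \<inter> N S2)"
          by (auto simp: N_def S)
        moreover have U: "(\<Union>j\<in>S1. A j \<inter> N S2) \<in> events"
          using A N_ev S2 S1 by (intro sets.finite_UN sets.Int) auto
        ultimately have "prob (N S2) \<le> prob (N S \<union> (\<Union>j\<in>S1. A j \<inter> N S2))"
          using N_ev less.prems by (intro finite_measure_mono sets.Un) auto
        also have "\<dots> \<le> prob (N S) + prob (\<Union>j\<in>S1. A j \<inter> N S2)"
          using N_ev less.prems U by (intro measure_Un_le) auto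
        finally show ?thesis .
      qed
      also have "prob (\<Union>j\<in>S1. A j \<inter> N S2) \<le> (\<Sum>j\<in>S1. prob (A j \<inter> N S2))"
        using A N_ev S2 S1 by (intro measure_UNION_le sets.Int) auto
      also have "\<dots> \<le> (\<Sum>j\<in>S1. 2 * p * prob (N S2))"
      proof (rule sum_mono)
        fix j assume j: "j \<in> S1"
        have "S2 \<subset> S"
          using j by (auto simp: S1_def S2_def)
        then have "card S2 < card S"
          by (intro psubset_card_mono) auto
        then show "prob (A j \<inter> N S2) \<le> 2 * p * prob (N S2)"
          using less.hyps[of S2 j] S2 S1 j by auto
      qed
      also have "\<dots> = real (card S1) * (2 * p * prob (N S2))"
        by simp
      also have "\<dots> \<le> real D * (2 * p * prob (N S2))"
      proof (intro mult_right_mono)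
        have "card S1 \<le> card (\<Gamma> i \<inter> I)"
          using S1 I by (intro card_mono) (auto simp: S1_def)
        then show "real (card S1) \<le> real D"
          using D(1)[OF less.prems(2)] by linarith
      qed (use p0 in auto)
      also have "\<dots> = (4 * p * real D) * (prob (N S2) / 2)"
        by simp
      also have "\<dots> \<le> prob (N S2) / 2"
        using pD by (intro mult_left_le_one_le) (use p0 in auto)
      finally show "prob (N S2) \<le> 2 * prob (N S)"
        by simp
    qed
    finally show ?case
      by simp
  qed
  have "prob (N S) > 0" if "S \<subseteq> I" for S
    using finite_subset[OF that I] that
  proof (induction S rule: finite_induct)
    case empty
    then show ?case
      by (simp add: N_def prob_space)
  next
    case (insert i S)
    have "p \<ge> 0"
      using order_trans[OF measure_nonneg p] insert.prems by blast
    then have "p * 1 \<le> p * real D"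
      using D(2) by (intro mult_left_mono) auto
    then have "2 * p < 1"
      using pD by linarith
    then have "2 * p * prob (N S) < prob (N S)"
      using insert mult_strict_right_mono[of "2 * p" 1 "prob (N S)"] by simp
    then have "prob (A i \<inter> N S) < prob (N S)"
      using main[of S i] insert.prems by auto
    then show ?case
      using N_insert[of i S] insert.prems by simp
  qed
  from this[of I] show ?thesis
    by (simp add: N_def)
qed

text \<open>Splitting the coordinates into \<open>S\<close> and \<open>V - S\<close> turns the
  random function into an independent pair; \<open>A\<close> reads only its first component and
  \<open>B\<close> only its second.\<close>

lemma prob_Pi_pmf_indep:
  assumes "finite V" "S \<subseteq> V" "S \<inter> T = {}"
    and A: "\<And>f g. (\<And>x. x \<in> S \<Longrightarrow> f x = g x) \<Longrightarrow> f \<in> A \<longleftrightarrow> g \<in> A"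
    and B: "\<And>f g. (\<And>x. x \<in> T \<Longrightarrow> f x = g x) \<Longrightarrow> f \<in> B \<longleftrightarrow> g \<in> B"
  shows "measure_pmf.prob (Pi_pmf V dflt P) (A \<inter> B) =
    measure_pmf.prob (Pi_pmf V dflt P) A * measure_pmf.prob (Pi_pmf V dflt P) B"
proof -
  define M1 M2 where "M1 = Pi_pmf S dflt P" and "M2 = Pi_pmf (V - S) dflt P"
  define h where "h = (\<lambda>(f, g) x. if x \<in> S then f x else (g x :: 'b))"
  have M: "Pi_pmf V dflt P = map_pmf h (pair_pmf M1 M2)"
    using Pi_pmf_union[of S "V - S" dflt P] assms(1,2)
    by (simp add: M1_def M2_def h_def finite_subset Un_absorb1)
  have hA: "h (f, g) \<in> A \<longleftrightarrow> f \<in> A" for f g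
    by (rule A) (simp add: h_def)
  have hB: "h (f, g) \<in> B \<longleftrightarrow> g \<in> B" for f g
    by (rule B) (use assms(3) in \<open>auto simp: h_def\<close>)
  have prod: "measure_pmf.prob (pair_pmf M1 M2) (A' \<times> B') = measure_pmf.prob M1 A' * measure_pmf.prob M2 B'" for A' B'
  proof -
    \<comment> \<open>Intersecting with the supports makes both factors countable, as the product
      formula requires.\<close>
    have "measure_pmf.prob (pair_pmf M1 M2) (A' \<times> B') =
        measure_pmf.prob (pair_pmf M1 M2) ((A' \<inter> set_pmf M1) \<times> (B' \<inter> set_pmf M2))"
      by (subst measure_Int_set_pmf[symmetric], rule arg_cong[where f = "measure_pmf.prob (pair_pmf M1 M2)"]) auto
    also have "\<dots> = measure_pmf.prob M1 (A' \<inter> set_pmf M1) * measure_pmf.prob M2 (B' \<inter> set_pmf M2)"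
      by (intro measure_pmf_prob_product) auto
    finally show ?thesis
      by (simp add: measure_Int_set_pmf)
  qed
  have "h -` A = A \<times> UNIV" "h -` B = UNIV \<times> B" "h -` (A \<inter> B) = A \<times> B"
    using hA hB by auto
  then show ?thesis
    by (simp add: M prod)
qed

text \<open>The count is a sum of independent indicators, hence binomial, and Hoeffding's lower tail
  applies. Upper bounds are obtained later from the complement of \<open>S\<close>.\<close>

lemma prob_Pi_pmf_card_le:
  fixes P :: "'b pmf"
  assumes "finite V" "N \<subseteq> V" "N \<noteq> {}" "\<epsilon> \<ge> 0"
  shows "measure_pmf.prob (Pi_pmf V dflt (\<lambda>_. P))
    {f. real (card {w\<in>N. f w \<in> S}) \<le> real (card N) * measure_pmf.prob P S - \<epsilon>} \<le> exp (- 2 * \<epsilon>\<^sup>2 / real (card N))"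
proof -
  define n q where "n = card N" and "q = measure_pmf.prob P S"
  have finN: "finite N"
    using assms finite_subset by auto
  have q: "q \<in> {0..1}"
    by (simp add: q_def)
  have "n > 0"
    using assms finN by (simp add: n_def card_gt_0_iff)
  have "map_pmf (\<lambda>f. card {w\<in>N. f w \<in> S}) (Pi_pmf V dflt (\<lambda>_. P)) =
      map_pmf (\<lambda>f. card {w\<in>N. f w \<in> S}) (Pi_pmf N dflt (\<lambda>_. P))"
    unfolding Pi_pmf_subset[OF assms(1,2)] pmf.map_comp o_def
    by (intro map_pmf_cong refl arg_cong[where f = card]) auto
  also have "\<dots> = map_pmf (\<lambda>f. card {w\<in>N. f w}) (Pi_pmf N (dflt \<in> S) (\<lambda>_. map_pmf (\<lambda>x. x \<in> S) P))"
    by (subst Pi_pmf_map[OF finN, where f = "\<lambda>x. x \<in> S"]) (simp_all add: pmf.map_comp o_def)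
  also have "map_pmf (\<lambda>x. x \<in> S) P = bernoulli_pmf q"
  proof (rule pmf_eqI)
    fix b
    have "measure_pmf.prob P (- S) = 1 - q"
      using measure_pmf.prob_compl[of S P] by (simp add: q_def Compl_eq_Diff_UNIV)
    moreover have "(\<lambda>x. x \<in> S) -` {b} = (if b then S else - S)"
      by auto
    ultimately show "pmf (map_pmf (\<lambda>x. x \<in> S) P) b = pmf (bernoulli_pmf q) b"
      using q by (auto simp: pmf_map q_def)
  qed
  also have "map_pmf (\<lambda>f. card {w\<in>N. f w}) (Pi_pmf N (dflt \<in> S) (\<lambda>_. bernoulli_pmf q)) = binomial_pmf n q"
    by (rule binomial_pmf_altdef'[symmetric]) (use finN q in \<open>auto simp: n_def\<close>)
  finally have bin: "map_pmf (\<lambda>f. card {w\<in>N. f w \<in> S}) (Pi_pmf V dflt (\<lambda>_. P)) = binomial_pmf n q" .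
  interpret binomial_distribution n q
    by standard (rule q)
  have "measure_pmf.prob (binomial_pmf n q) {x. real x \<le> real n * q - \<epsilon>} \<le> exp (- 2 * \<epsilon>\<^sup>2 / real n)"
    by (rule prob_le[OF \<open>n > 0\<close> assms(4)])
  then show ?thesis
    unfolding bin[symmetric] by (simp add: n_def q_def vimage_def)
qed


text \<open>The bad event at \<open>v\<close> is that some union of pieces is under-represented in
  \<open>N v\<close>. It depends only on the labels in \<open>N v\<close>, hence only on the events
  at vertices sharing a neighbour with \<open>v\<close>, at most \<open>d\<^sup>2\<close> in number.
  The factor \<open>2 ^ card U\<close> is the union bound over all \<open>S\<close>.\<close>

lemma exists_balanced_partition:
  fixes P :: "'b pmf"
  assumes V: "finite V" and N: "\<And>v. v \<in> V \<Longrightarrow> N v \<subseteq> V" "\<And>v. v \<in> V \<Longrightarrow> card (N v) = d"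
    and sym: "\<And>v w. v \<in> V \<Longrightarrow> w \<in> N v \<Longrightarrow> v \<in> N w"
    and "d > 0" "finite U" "\<epsilon> \<ge> 0"
    and small: "4 * (2 ^ card U * exp (- 2 * \<epsilon>\<^sup>2 / real d)) * real (d\<^sup>2) \<le> 1"
  obtains f where "\<And>v. v \<in> V \<Longrightarrow> f v \<in> set_pmf P"
    and "\<And>v S. v \<in> V \<Longrightarrow> S \<subseteq> U \<Longrightarrow> real (card {w\<in>N v. f w \<in> S}) > real d * measure_pmf.prob P S - \<epsilon>"
proof -
  define M where "M = Pi_pmf V undefined (\<lambda>_. P)"
  define bad where "bad v S = {f. real (card {w\<in>N v. f w \<in> S}) \<le> real d * measure_pmf.prob P S - \<epsilon>}" for v S
  define A where "A v = (\<Union>S\<in>Pow U. bad v S)" for v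
  define \<Gamma> where "\<Gamma> v = {u\<in>V. N u \<inter> N v \<noteq> {}}" for v
  have dep: "f \<in> A v \<longleftrightarrow> g \<in> A v" if "\<And>x. x \<in> N v \<Longrightarrow> f x = g x" for f g v
  proof -
    have "{w\<in>N v. f w \<in> S} = {w\<in>N v. g w \<in> S}" for S
      using that by auto
    then show ?thesis
      by (simp add: A_def bad_def)
  qed
  have "measure_pmf.prob M (space M - (\<Union>v\<in>V. A v)) > 0"
  proof (rule measure_pmf.lovasz_local[OF V])
    fix v S assume v: "v \<in> V" "S \<subseteq> V - \<Gamma> v"
    show "measure_pmf.prob M (A v \<inter> (space M - (\<Union>j\<in>S. A j))) =
        measure_pmf.prob M (A v) * measure_pmf.prob M (space M - (\<Union>j\<in>S. A j))"
      unfolding M_def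
    proof (rule prob_Pi_pmf_indep[where S = "N v" and T = "\<Union>j\<in>S. N j"])
      fix f g :: "'a \<Rightarrow> 'b" assume fg: "\<And>x. x \<in> (\<Union>j\<in>S. N j) \<Longrightarrow> f x = g x"
      have "f \<in> A j \<longleftrightarrow> g \<in> A j" if "j \<in> S" for j
        by (rule dep) (use fg that in auto)
      then show "f \<in> space (Pi_pmf V undefined (\<lambda>_. P)) - (\<Union>j\<in>S. A j) \<longleftrightarrow>
          g \<in> space (Pi_pmf V undefined (\<lambda>_. P)) - (\<Union>j\<in>S. A j)"
        by auto
    qed (use v N V in \<open>auto simp: \<Gamma>_def intro!: dep\<close>)
  next
    fix v assume v: "v \<in> V"
    have Nv: "N v \<noteq> {}" "finite (N v)"
      using N[OF v] \<open>d > 0\<close> finite_subset[OF _ V] by auto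
    have "measure_pmf.prob M (A v) \<le> (\<Sum>S\<in>Pow U. measure_pmf.prob M (bad v S))"
      unfolding A_def using \<open>finite U\<close> by (intro measure_UNION_le) auto
    also have "\<dots> \<le> (\<Sum>S\<in>Pow U. exp (- 2 * \<epsilon>\<^sup>2 / real d))"
    proof (rule sum_mono)
      fix S
      show "measure_pmf.prob M (bad v S) \<le> exp (- 2 * \<epsilon>\<^sup>2 / real d)"
        using prob_Pi_pmf_card_le[OF V N(1)[OF v] Nv(1) \<open>\<epsilon> \<ge> 0\<close>, of undefined P S] N(2)[OF v]
        by (simp add: M_def bad_def)
    qed
    also have "\<dots> = 2 ^ card U * exp (- 2 * \<epsilon>\<^sup>2 / real d)"
      using \<open>finite U\<close> by (simp add: card_Pow)
    finally show "measure_pmf.prob M (A v) \<le> 2 ^ card U * exp (- 2 * \<epsilon>\<^sup>2 / real d)" .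
    have "card (\<Gamma> v \<inter> V) \<le> card (\<Union>w\<in>N v. N w)"
    proof (rule card_mono)
      show "finite (\<Union>w\<in>N v. N w)"
        using N[OF v] N(1) V by (intro finite_UN_I Nv) (auto intro: finite_subset)
      show "\<Gamma> v \<inter> V \<subseteq> (\<Union>w\<in>N v. N w)"
        using sym by (auto simp: \<Gamma>_def)
    qed
    also have "\<dots> \<le> (\<Sum>w\<in>N v. card (N w))"
      by (rule card_UN_le) (rule Nv)
    also have "\<dots> = (\<Sum>w\<in>N v. d)"
      using N v by (intro sum.cong) auto
    also have "\<dots> = d\<^sup>2"
      using N(2)[OF v] by (simp add: power2_eq_square)
    finally show "card (\<Gamma> v \<inter> V) \<le> d\<^sup>2" .
  qed (use \<open>d > 0\<close> small in auto)
  \<comment> \<open>The labelling is taken from the support of \<open>M\<close>, which forces its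
    labels into \<open>set_pmf P\<close>.\<close>
  then have "set_pmf M \<inter> (UNIV - (\<Union>v\<in>V. A v)) \<noteq> {}"
    using measure_pmf_zero_iff[of M "UNIV - (\<Union>v\<in>V. A v)"] by auto
  then obtain f where f: "f \<in> set_pmf M" "\<And>v. v \<in> V \<Longrightarrow> f \<notin> A v"
    by auto
  show ?thesis
  proof
    show "f v \<in> set_pmf P" if "v \<in> V" for v
      using f(1) that V by (auto simp: M_def set_Pi_pmf PiE_dflt_def)
    show "real (card {w\<in>N v. f w \<in> S}) > real d * measure_pmf.prob P S - \<epsilon>" if "v \<in> V" "S \<subseteq> U" for v S
      using f(2)[OF that(1)] that(2) by (auto simp: A_def bad_def not_le)
  qed
qed

subsection \<open>Greedy choice of the adjustable colours\<close>

definition colour_degree :: "('a \<Rightarrow> 'a set) \<Rightarrow> ('a \<Rightarrow> 'a \<Rightarrow> nat) \<Rightarrow> nat \<Rightarrow> 'a \<Rightarrow> nat" where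
  "colour_degree N c i v = card {w \<in> N v. c v w = i}"

text \<open>Here \<open>T p\<close> lists the pieces to which \<open>p\<close> owns the edges, and
  \<open>\<alpha> p p\<close> is the inner colour of \<open>p\<close>. Vertices are treated in order
  of increasing piece; \<open>room\<close> leaves more reachable inner degrees than forbidden ones,
  and \<open>T_le\<close> keeps recolouring from disturbing the inner degrees of vertices already
  treated.\<close>

lemma exists_internally_irregular_colouring:
  fixes N :: "'a \<Rightarrow> 'a set" and \<pi> :: "'a \<Rightarrow> nat" and \<alpha> \<beta> :: "nat \<Rightarrow> nat \<Rightarrow> nat" and T :: "nat \<Rightarrow> nat set"
  assumes V: "finite V"
    and N: "\<And>v. v \<in> V \<Longrightarrow> N v \<subseteq> V" "\<And>v. v \<notin> N v" "\<And>v w. w \<in> N v \<longleftrightarrow> v \<in> N w"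
    and \<pi>: "\<And>v. v \<in> V \<Longrightarrow> \<pi> v < m"
    and sym: "\<And>p q. p < m \<Longrightarrow> q < m \<Longrightarrow> \<alpha> p q = \<alpha> q p \<and> \<beta> p q = \<beta> q p"
    and T: "\<And>p q. p < m \<Longrightarrow> q \<in> T p \<Longrightarrow> \<alpha> p q = \<alpha> p p \<and> \<beta> p q \<noteq> \<alpha> p p"
    and T_le: "\<And>p q. p < m \<Longrightarrow> q \<in> T p \<Longrightarrow> q \<le> p \<Longrightarrow> \<alpha> q q \<notin> {\<alpha> p q, \<beta> p q}"
    and room: "\<And>v. v \<in> V \<Longrightarrow> card {w \<in> N v. \<pi> w = \<pi> v} \<le> card {w \<in> N v. \<pi> w \<in> T (\<pi> v)}"
  obtains c where "\<And>u v. u \<in> V \<Longrightarrow> v \<in> V \<Longrightarrow> c u v = c v u \<and> c u v \<in> {\<alpha> (\<pi> u) (\<pi> v), \<beta> (\<pi> u) (\<pi> v)}"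
    and "\<And>u v. u \<in> V \<Longrightarrow> v \<in> N u \<Longrightarrow> \<pi> u = \<pi> v \<Longrightarrow>
      colour_degree N c (\<alpha> (\<pi> u) (\<pi> u)) u \<noteq> colour_degree N c (\<alpha> (\<pi> u) (\<pi> u)) v"
proof -
  have finN: "finite (N v)" if "v \<in> V" for v
    using finite_subset[OF N(1) V] that by auto
  define valid where
    "valid c \<longleftrightarrow> (\<forall>u\<in>V. \<forall>v\<in>V. c u v = c v u \<and> c u v \<in> {\<alpha> (\<pi> u) (\<pi> v), \<beta> (\<pi> u) (\<pi> v)})" for c
  define good where
    "good c S \<longleftrightarrow> (\<forall>u\<in>S. \<forall>v\<in>S. v \<in> N u \<longrightarrow> \<pi> u = \<pi> v \<longrightarrow>
      colour_degree N c (\<alpha> (\<pi> u) (\<pi> u)) u \<noteq> colour_degree N c (\<alpha> (\<pi> u) (\<pi> u)) v)" for c S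
  have "\<exists>c. valid c \<and> good c S" if "S \<subseteq> V" for S
    using finite_subset[OF that V] that
  \<comment> \<open>Each inserted vertex \<open>x\<close> has a piece number at least that of every
    vertex of \<open>S\<close>, which is what \<open>T_le\<close> needs.\<close>
  proof (induction S rule: finite_ranking_induct[where f = \<pi>])
    case empty
    have "valid (\<lambda>u v. \<alpha> (\<pi> u) (\<pi> v))"
      using sym \<pi> by (simp add: valid_def)
    then show ?case
      by (auto simp: good_def)
  next
    case (insert x S)
    show ?case
    proof (cases "x \<in> S")
      case True
      then show ?thesis
        using insert by (simp add: insert_absorb)
    next
      case False
      obtain c where c: "valid c" "good c S"
        using insert by auto
      have x: "x \<in> V" and S: "S \<subseteq> V"
        using insert by auto
      define k where "k = \<alpha> (\<pi> x) (\<pi> x)"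
      define W where "W = {w \<in> N x. \<pi> w \<in> T (\<pi> x)}"
      \<comment> \<open>\<open>F\<close> holds the forbidden degrees and \<open>b\<close> the part
        of the inner degree of \<open>x\<close> that stays fixed. Giving the inner colour to
        \<open>j\<close> of the owned edges realises \<open>b + j\<close>; the
        \<open>card W + 1\<close> values of \<open>j\<close> outnumber \<open>F\<close>.\<close>
      define F where "F = (\<lambda>u. colour_degree N c k u) ` {u \<in> N x. \<pi> u = \<pi> x}"
      define b where "b = card {w \<in> N x - W. c x w = k}"
      have W: "W \<subseteq> N x" "finite W"
        using finN[OF x] by (auto simp: W_def)
      have "card F \<le> card {u \<in> N x. \<pi> u = \<pi> x}"
        unfolding F_def using finN[OF x] by (intro card_image_le) auto
      also have "\<dots> < card ((\<lambda>j. b + j) ` {..card W})"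
        using room[OF x] by (simp add: W_def card_image)
      finally have "\<not> (\<lambda>j. b + j) ` {..card W} \<subseteq> F"
        using card_mono[of F "(\<lambda>j. b + j) ` {..card W}"] finN[OF x] by (force simp: F_def)
      then obtain j where j: "j \<le> card W" "b + j \<notin> F"
        by auto
      obtain X where X: "X \<subseteq> W" "card X = j"
        using j(1) by (meson obtain_subset_with_card_n)
      define new where "new w = (if w \<in> X then k else \<beta> (\<pi> x) (\<pi> w))" for w
      define c' where "c' u v = (if u = x \<and> v \<in> W then new v else if v = x \<and> u \<in> W then new u else c u v)" for u v
      have xW: "x \<notin> W"
        using W N(2) by auto
      have WV: "W \<subseteq> V"
        using W(1) N(1)[OF x] by auto
      have new: "new w \<in> {\<alpha> (\<pi> x) (\<pi> w), \<beta> (\<pi> x) (\<pi> w)}" if "w \<in> W" for w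
        using T[OF \<pi>[OF x]] that by (auto simp: new_def W_def k_def)
      have valid': "valid c'"
        unfolding valid_def
      proof (intro ballI)
        fix u v assume uv: "u \<in> V" "v \<in> V"
        have "c u v = c v u" "c u v \<in> {\<alpha> (\<pi> u) (\<pi> v), \<beta> (\<pi> u) (\<pi> v)}"
          using c(1) uv by (auto simp: valid_def)
        then show "c' u v = c' v u \<and> c' u v \<in> {\<alpha> (\<pi> u) (\<pi> v), \<beta> (\<pi> u) (\<pi> v)}"
          using new[of u] new[of v] sym[OF \<pi> \<pi>, OF uv] xW by (auto simp: c'_def)
      qed
      \<comment> \<open>Only edges between \<open>x\<close> and \<open>W\<close> change. For such an
        edge with other end \<open>u\<close> in \<open>S\<close>, neither permitted colour is the
        inner colour of \<open>u\<close>.\<close>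
      have same: "colour_degree N c' (\<alpha> (\<pi> u) (\<pi> u)) u = colour_degree N c (\<alpha> (\<pi> u) (\<pi> u)) u" if u: "u \<in> S" for u
      proof -
        have "c' u w = \<alpha> (\<pi> u) (\<pi> u) \<longleftrightarrow> c u w = \<alpha> (\<pi> u) (\<pi> u)" for w
        proof (cases "w = x \<and> u \<in> W")
          case True
          have u': "u \<in> V"
            using u S by auto
          note swap = sym[OF \<pi>[OF u'] \<pi>[OF x]]
          have "\<alpha> (\<pi> u) (\<pi> u) \<notin> {\<alpha> (\<pi> u) (\<pi> x), \<beta> (\<pi> u) (\<pi> x)}"
            unfolding conjunct1[OF swap] conjunct2[OF swap]
            using T_le[OF \<pi>[OF x], of "\<pi> u"] insert.hyps u True by (auto simp: W_def)
          moreover have "c u x \<in> {\<alpha> (\<pi> u) (\<pi> x), \<beta> (\<pi> u) (\<pi> x)}"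
            using c(1) x u' by (simp add: valid_def)
          moreover have "c' u x \<in> {\<alpha> (\<pi> u) (\<pi> x), \<beta> (\<pi> u) (\<pi> x)}"
            using valid' x u' by (simp add: valid_def)
          ultimately have "c u x \<noteq> \<alpha> (\<pi> u) (\<pi> u)" "c' u x \<noteq> \<alpha> (\<pi> u) (\<pi> u)"
            by metis+
          then show ?thesis
            using True by simp
        next
          case False
          then show ?thesis
            using \<open>x \<notin> S\<close> u by (auto simp: c'_def)
        qed
        then show ?thesis
          by (simp add: colour_degree_def)
      qed
      have "colour_degree N c' k x = b + j"
      proof -
        have "\<beta> (\<pi> x) (\<pi> w) \<noteq> k" if "w \<in> W" for w
          using T[OF \<pi>[OF x], of "\<pi> w"] that by (simp add: W_def k_def)
        moreover have "c' x w = (if w \<in> W then new w else c x w)" for w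
          using xW by (simp add: c'_def)
        ultimately have "{w \<in> N x. c' x w = k} = {w \<in> N x - W. c x w = k} \<union> X"
          using X(1) W(1) by (auto simp: new_def split: if_splits)
        moreover have "{w \<in> N x - W. c x w = k} \<inter> X = {}"
          using X(1) by auto
        ultimately show ?thesis
          using X finN[OF x] W finite_subset[OF X(1)]
          by (simp add: colour_degree_def b_def card_Un_disjoint)
      qed
      moreover have "colour_degree N c' k u \<in> F" if "u \<in> S" "u \<in> N x" "\<pi> u = \<pi> x" for u
        using same[OF that(1)] that by (auto simp: F_def k_def)
      ultimately have x_ne: "colour_degree N c' k x \<noteq> colour_degree N c' k u" if "u \<in> S" "u \<in> N x" "\<pi> u = \<pi> x" for u
        using that j(2) by metis
      have "good c' (insert x S)"
        unfolding good_def
      proof (intro ballI impI)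
        fix u v assume uv: "u \<in> insert x S" "v \<in> insert x S" "v \<in> N u" "\<pi> u = \<pi> v"
        consider "u = x" "v \<in> S" | "v = x" "u \<in> S" | "u \<in> S" "v \<in> S"
          using uv N(2) by auto
        then show "colour_degree N c' (\<alpha> (\<pi> u) (\<pi> u)) u \<noteq> colour_degree N c' (\<alpha> (\<pi> u) (\<pi> u)) v"
        proof cases
          case 1
          then show ?thesis
            using x_ne[of v] uv by (simp add: k_def)
        next
          case 2
          then show ?thesis
            using x_ne[of u] uv N(3)[of v u] by (simp add: k_def)
        next
          case 3
          then show ?thesis
            using same[of u] same[of v] c(2) uv unfolding good_def by metis
        qed
      qed
      then show ?thesis
        using valid' by blast
    qed
  qed
  from this[of V] obtain c where "valid c" "good c V"
    by auto
  then show ?thesis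
    using that[of c] N(1) unfolding valid_def good_def by blast
qed

lemma colour_degree_bounds:
  assumes "finite (N v)" "\<And>w. w \<in> N v \<Longrightarrow> c v w \<in> {\<alpha> (\<pi> v) (\<pi> w), \<beta> (\<pi> v) (\<pi> w)}"
  shows "card {w \<in> N v. \<alpha> (\<pi> v) (\<pi> w) = i \<and> \<beta> (\<pi> v) (\<pi> w) = i} \<le> colour_degree N c i v"
    and "colour_degree N c i v \<le> card {w \<in> N v. \<alpha> (\<pi> v) (\<pi> w) = i \<or> \<beta> (\<pi> v) (\<pi> w) = i}"
  unfolding colour_degree_def by (intro card_mono; use assms in force)+

subsection \<open>The pieces and their colours\<close>

text \<open>
  Piece \<open>p\<close> receives a vertex with probability \<open>piece_weight p / 62\<close>. Edges between pieces \<open>p\<close> and \<open>q\<close>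
  are coloured \<open>primary p q\<close> or \<open>secondary p q\<close>; if these differ, then exactly one of the two pieces
  has the other one among its \<open>targets\<close>, and the choice is made at the vertices of that piece.
  The tables were found by a computer search. The margin of \<open>2\<close> units in \<open>table_room\<close> and
  \<open>table_separated\<close> absorbs a deviation of one unit, that is of \<open>d / 62\<close> neighbours, on each side.
\<close>

definition piece_weight :: "nat \<Rightarrow> nat" where
  "piece_weight p = [12, 14, 2, 16, 10, 8] ! p"

definition primary :: "nat \<Rightarrow> nat \<Rightarrow> nat" where
  "primary p q =
    [[2, 1, 2, 2, 3, 3],
     [1, 1, 1, 1, 3, 3],
     [2, 1, 1, 4, 3, 1],
     [2, 1, 4, 4, 4, 4],
     [3, 3, 3, 4, 3, 2],
     [3, 3, 1, 4, 2, 3]] ! p ! q"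

definition secondary :: "nat \<Rightarrow> nat \<Rightarrow> nat" where
  "secondary p q =
    [[2, 1, 2, 4, 1, 3],
     [1, 1, 1, 4, 3, 2],
     [2, 1, 1, 4, 3, 3],
     [4, 4, 4, 4, 3, 3],
     [1, 3, 3, 3, 3, 2],
     [3, 2, 3, 3, 2, 3]] ! p ! q"

definition targets :: "nat \<Rightarrow> nat set" where
  "targets p = [{3}, {3}, {5}, {4, 5}, {0}, {1}] ! p"

text \<open>Divided by 62, the weights of \<open>sure p i\<close> and \<open>possible p i\<close>
  bound from below and above the expected proportion of colour \<open>i\<close> at a vertex of piece
  \<open>p\<close>, whatever choices are made.\<close>

definition sure :: "nat \<Rightarrow> nat \<Rightarrow> nat set" where
  "sure p i = {r. r < 6 \<and> primary p r = i \<and> secondary p r = i}"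

definition possible :: "nat \<Rightarrow> nat \<Rightarrow> nat set" where
  "possible p i = {r. r < 6 \<and> (primary p r = i \<or> secondary p r = i)}"

lemma sum_lessThan_6: "(\<Sum>r<6. f r) = f 0 + f 1 + f 2 + f 3 + f 4 + f (5::nat)"
  by (simp add: numeral_eq_Suc)

lemma all_less_6: "(\<forall>p<6. Q p) \<longleftrightarrow> Q 0 \<and> Q 1 \<and> Q 2 \<and> Q 3 \<and> Q 4 \<and> Q (5::nat)"
  by (simp add: numeral_eq_Suc All_less_Suc conj_ac)

lemma sum_piece_weight_sure:
  "sum piece_weight (sure p i) = (\<Sum>r<6. if primary p r = i \<and> secondary p r = i then piece_weight r else 0)"
proof -
  have "sure p i = {r \<in> {..<6}. primary p r = i \<and> secondary p r = i}"
    by (auto simp: sure_def)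
  then show ?thesis
    by (simp only: sum.inter_filter[OF finite_lessThan])
qed

lemma sum_piece_weight_possible:
  "sum piece_weight (possible p i) = (\<Sum>r<6. if primary p r = i \<or> secondary p r = i then piece_weight r else 0)"
proof -
  have "possible p i = {r \<in> {..<6}. primary p r = i \<or> secondary p r = i}"
    by (auto simp: possible_def)
  then show ?thesis
    by (simp only: sum.inter_filter[OF finite_lessThan])
qed

lemma sum_piece_weight: "sum piece_weight {..<6} = 62"
  by (simp add: sum_lessThan_6 piece_weight_def)

lemma table_symmetric:
  "\<forall>p<6. \<forall>q<6. primary p q = primary q p \<and> secondary p q = secondary q p"
  by (simp add: all_less_6 primary_def secondary_def)

lemma table_colours: "\<forall>p<6. \<forall>q<6. primary p q \<in> {1..4} \<and> secondary p q \<in> {1..4}"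
  by (simp add: all_less_6 primary_def secondary_def)

lemma table_diagonal: "\<forall>p<6. secondary p p = primary p p"
  by (simp add: all_less_6 primary_def secondary_def)

text \<open>Only pieces 4 and 5 own edges to an earlier piece, namely 0 and 1. The inner colours 2
  and 1 found there avoid the permitted pairs 3, 1 and 3, 2.\<close>

lemma table_targets:
  "\<forall>p<6. \<forall>q\<in>targets p. q < 6 \<and> primary p q = primary p p \<and> secondary p q \<noteq> primary p p \<and>
    (q \<le> p \<longrightarrow> primary q q \<notin> {primary p q, secondary p q})"
  by (simp add: all_less_6 primary_def secondary_def targets_def)

lemma table_room: "\<forall>p<6. piece_weight p + 2 \<le> sum piece_weight (targets p)"
  by (simp add: all_less_6 piece_weight_def targets_def)

lemma table_separated:
  "\<forall>p<6. \<forall>q<6. p \<noteq> q \<longrightarrow> (\<forall>i\<in>{primary p q, secondary p q}.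
    sum piece_weight (possible q i) + 2 \<le> sum piece_weight (sure p i) \<or>
    sum piece_weight (possible p i) + 2 \<le> sum piece_weight (sure q i))"
  unfolding sum_piece_weight_sure sum_piece_weight_possible sum_lessThan_6
  by (simp add: all_less_6 primary_def secondary_def piece_weight_def)

section \<open>Probabilities of the pieces and the numerical condition on the degree\<close>

lemma piece_pmf:
  obtains P :: "nat pmf" where "set_pmf P \<subseteq> {..<6}"
    and "\<And>S. S \<subseteq> {..<6} \<Longrightarrow> measure_pmf.prob P S = real (sum piece_weight S) / 62"
proof
  define xs where "xs = map (\<lambda>p. (p, real (piece_weight p) / 62)) [0..<6]"
  have sum_xs: "sum_list (map snd (filter (\<lambda>x. fst x \<in> S) xs)) = real (sum piece_weight S) / 62"
    if "S \<subseteq> {..<6}" for S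
  proof -
    have "sum_list (map snd (filter (\<lambda>x. fst x \<in> S) xs)) =
        (\<Sum>p\<leftarrow>filter (\<lambda>p. p \<in> S) [0..<6]. real (piece_weight p) / 62)"
      by (simp only: xs_def filter_map map_map o_def fst_conv snd_conv)
    also have "\<dots> = (\<Sum>p\<in>set (filter (\<lambda>p. p \<in> S) [0..<6]). real (piece_weight p) / 62)"
      by (rule sum_list_distinct_conv_sum_set) (rule distinct_filter[OF distinct_upt])
    also have "set (filter (\<lambda>p. p \<in> S) [0..<6]) = S"
      using that by auto
    finally show ?thesis
      by (simp add: sum_divide_distrib)
  qed
  have "filter (\<lambda>x. fst x \<in> {..<6}) xs = xs"
    by (auto simp: xs_def filter_id_conv)
  then have wf: "pmf_of_list_wf xs"
    using sum_xs[of "{..<6}"] sum_piece_weight by (intro pmf_of_list_wfI) (auto simp: xs_def)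
  show "set_pmf (pmf_of_list xs) \<subseteq> {..<6}"
    using set_pmf_of_list[OF wf] by (auto simp: xs_def)
  show "measure_pmf.prob (pmf_of_list xs) S = real (sum piece_weight S) / 62" if "S \<subseteq> {..<6}" for S
    using measure_pmf_of_list[OF wf] sum_xs[OF that] by simp
qed

text \<open>With six pieces and deviation \<open>d / 62\<close> the local lemma condition becomes
  \<open>256 * d\<^sup>2 \<le> exp (d / 1922)\<close>; this is where the bound 54000 enters.\<close>

lemma tail_bound_54000:
  assumes "d \<ge> 54000"
  shows "4 * (2 ^ card {..<6::nat} * exp (- 2 * (real d / 62)\<^sup>2 / real d)) * real (d\<^sup>2) \<le> 1"
proof -
  \<comment> \<open>The scale 3844 is twice 1922, so \<open>exp (d / 1922)\<close> splits off the
    square of \<open>exp y\<close>, and \<open>exp y \<ge> 1 + y\<close> covers the growth of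
    \<open>16 * d\<close>. At the start, \<open>16 * 54000\<close> is below
    \<open>2 ^ 20\<close>.\<close>
  define y where "y = (real d - 54000) / 3844"
  have y: "y \<ge> 0"
    using assms by (simp add: y_def)
  have "16 * real d \<le> 2 ^ 20 * (1 + y)"
    using assms by (simp add: y_def field_simps)
  then have "(16 * real d)\<^sup>2 \<le> (2 ^ 20 * (1 + y))\<^sup>2"
    by (intro power_mono) auto
  also have "\<dots> = 2 ^ 40 * (1 + y)\<^sup>2"
    by (subst power_mult_distrib) simp
  also have "\<dots> \<le> exp (54000 / 1922) * (exp y)\<^sup>2"
  proof (intro mult_mono power_mono exp_ge_add_one_self)
    have "40 * ln 2 \<le> 54000 / (1922::real)"
      using ln2_le_25_over_36 by simp
    then have "exp (40 * ln 2) \<le> exp (54000 / (1922::real))"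
      by simp
    also have "exp (40 * ln 2) = (2::real) ^ 40"
      using exp_of_nat_mult[of 40 "ln (2::real)"] by simp
    finally show "(2::real) ^ 40 \<le> exp (54000 / 1922)" .
  qed (use y in auto)
  also have "\<dots> = exp (54000 / 1922 + 2 * y)"
    by (simp add: exp_add exp_double)
  also have "54000 / 1922 + 2 * y = real d / 1922"
    by (simp add: y_def field_simps)
  finally have le: "256 * (real d)\<^sup>2 \<le> exp (real d / 1922)"
    by (simp add: power_mult_distrib)
  have eq: "- 2 * (real d / 62)\<^sup>2 / real d = - (real d / 1922)"
    using assms by (simp add: field_simps power2_eq_square)
  show ?thesis
    unfolding eq using le by (simp add: exp_minus field_simps)
qed

section \<open>Assembly of the decomposition\<close>

theorem theorem4:
  fixes d :: nat and V :: "'a set" and E :: "'a set set"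
  assumes "d \<ge> 54000"
    and "simple_graph V E"
    and "regular_graph d V E"
  shows "lir_decomposable 4 V E"
proof -
  define N where "N v = {w. {v, w} \<in> E}" for v
  have V: "finite V" and E: "\<And>e. e \<in> E \<Longrightarrow> e \<subseteq> V \<and> card e = 2"
    using assms(2) by (auto simp: simple_graph_def)
  have NV: "N v \<subseteq> V" for v
    using E by (auto simp: N_def)
  have irrefl: "v \<notin> N v" for v
    using E by (force simp: N_def)
  have sym: "w \<in> N v \<longleftrightarrow> v \<in> N w" for v w
    by (simp add: N_def insert_commute)
  have finN: "finite (N v)" for v
    using finite_subset[OF NV V] .
  have graph_degree: "graph_degree F v = card {w. {v, w} \<in> F}" if "F \<subseteq> E" for F v
  proof -
    have "bij_betw (\<lambda>w. {v, w}) {w. {v, w} \<in> F} {e \<in> F. v \<in> e}"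
      unfolding bij_betw_def
    proof
      show "inj_on (\<lambda>w. {v, w}) {w. {v, w} \<in> F}"
        by (auto simp: inj_on_def doubleton_eq_iff)
      show "(\<lambda>w. {v, w}) ` {w. {v, w} \<in> F} = {e \<in> F. v \<in> e}"
      proof (intro equalityI subsetI)
        fix e assume e: "e \<in> {e \<in> F. v \<in> e}"
        then have "card e = 2"
          using E that by auto
        then obtain a b where "e = {a, b}"
          by (auto simp: card_2_iff)
        then show "e \<in> (\<lambda>w. {v, w}) ` {w. {v, w} \<in> F}"
          using e by (auto simp: insert_commute)
      qed auto
    qed
    then show ?thesis
      by (simp add: graph_degree_def bij_betw_same_card)
  qed
  have deg: "card (N v) = d" if "v \<in> V" for v
    using graph_degree[of E v] assms(3) that by (simp add: regular_graph_def N_def)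

  obtain P :: "nat pmf" where P: "set_pmf P \<subseteq> {..<6}"
    "\<And>S. S \<subseteq> {..<6} \<Longrightarrow> measure_pmf.prob P S = real (sum piece_weight S) / 62"
    using piece_pmf by blast
  obtain \<pi> where "\<And>v. v \<in> V \<Longrightarrow> \<pi> v \<in> set_pmf P"
    and bal: "\<And>v S. v \<in> V \<Longrightarrow> S \<subseteq> {..<6} \<Longrightarrow>
      real (card {w\<in>N v. \<pi> w \<in> S}) > real d * measure_pmf.prob P S - real d / 62"
  proof (rule exists_balanced_partition[where P = P and N = N, OF V NV deg _ _ _ _ tail_bound_54000[OF assms(1)]])
    show "v \<in> N w" if "w \<in> N v" for v w
      using that sym by blast
  qed (use assms(1) in auto)
  then have \<pi>: "\<pi> v < 6" if "v \<in> V" for v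
    using P(1) that by blast
  define cnt where "cnt v S = card {w\<in>N v. \<pi> w \<in> S}" for v S
  \<comment> \<open>Multiplying by 62 moves the estimates to natural numbers; the extra
    \<open>d\<close> is a deviation of one weight unit.\<close>
  have cnt_lower: "d * sum piece_weight S < 62 * cnt v S + d" if "v \<in> V" "S \<subseteq> {..<6}" for v S
  proof -
    have "real d * real (sum piece_weight S) < 62 * real (cnt v S) + real d"
      using bal[OF that] P(2)[OF that(2)] by (simp add: cnt_def field_simps)
    then have "real (d * sum piece_weight S) < real (62 * cnt v S + d)"
      by simp
    then show ?thesis
      by (simp only: of_nat_less_iff)
  qed
  \<comment> \<open>Since the degree is exactly \<open>d\<close> and the weights add up to 62, the
    lower bound for the complementary pieces yields the upper bound.\<close>
  have cnt_upper: "62 * cnt v S < d * sum piece_weight S + d" if "v \<in> V" "S \<subseteq> {..<6}" for v S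
  proof -
    have "N v = {w\<in>N v. \<pi> w \<in> S} \<union> {w\<in>N v. \<pi> w \<in> {..<6} - S}"
      using \<pi> NV by auto
    then have "d = card ({w\<in>N v. \<pi> w \<in> S} \<union> {w\<in>N v. \<pi> w \<in> {..<6} - S})"
      using deg[OF that(1)] by simp
    also have "\<dots> = cnt v S + cnt v ({..<6} - S)"
      unfolding cnt_def using finN[of v] by (intro card_Un_disjoint) auto
    finally have d: "d = cnt v S + cnt v ({..<6} - S)" .
    have "sum piece_weight S + sum piece_weight ({..<6} - S) = 62"
      using sum.subset_diff[OF that(2), of piece_weight] sum_piece_weight by simp
    then have "d * sum piece_weight S + d * sum piece_weight ({..<6} - S) = d * 62"
      by (metis distrib_left)
    then show ?thesis
      using cnt_lower[OF that(1), of "{..<6} - S"] d by auto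
  qed
  \<comment> \<open>One unit of deviation at each end consumes the margin of two; strictness comes
    from the strict estimates.\<close>
  have cnt_less: "cnt u S < cnt v S'"
    if "u \<in> V" "v \<in> V" "S \<subseteq> {..<6}" "S' \<subseteq> {..<6}" "sum piece_weight S + 2 \<le> sum piece_weight S'" for u v S S'
  proof -
    have "d * (sum piece_weight S + 2) \<le> d * sum piece_weight S'"
      using that(5) by (rule mult_le_mono2)
    then show ?thesis
      using cnt_upper[OF that(1,3)] cnt_lower[OF that(2,4)] by (simp add: distrib_left)
  qed

  obtain c where c: "\<And>u v. u \<in> V \<Longrightarrow> v \<in> V \<Longrightarrow>
      c u v = c v u \<and> c u v \<in> {primary (\<pi> u) (\<pi> v), secondary (\<pi> u) (\<pi> v)}"
    and internal: "\<And>u v. u \<in> V \<Longrightarrow> v \<in> N u \<Longrightarrow> \<pi> u = \<pi> v \<Longrightarrow>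
      colour_degree N c (primary (\<pi> u) (\<pi> u)) u \<noteq> colour_degree N c (primary (\<pi> u) (\<pi> u)) v"
  proof (rule exists_internally_irregular_colouring[where N = N and \<pi> = \<pi> and m = 6
        and \<alpha> = primary and \<beta> = secondary and T = targets, OF V NV irrefl sym \<pi>])
    fix v assume v: "v \<in> V"
    have "targets (\<pi> v) \<subseteq> {..<6}"
      using table_targets \<pi>[OF v] by auto
    then have "cnt v {\<pi> v} < cnt v (targets (\<pi> v))"
      using table_room \<pi>[OF v] by (intro cnt_less v) auto
    then show "card {w \<in> N v. \<pi> w = \<pi> v} \<le> card {w \<in> N v. \<pi> w \<in> targets (\<pi> v)}"
      by (simp add: cnt_def)
  next
    show "primary p q = primary q p \<and> secondary p q = secondary q p" if "p < 6" "q < 6" for p q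
      using table_symmetric that by simp
  next
    show "primary p q = primary p p \<and> secondary p q \<noteq> primary p p" if "p < 6" "q \<in> targets p" for p q
      using table_targets that by simp
  next
    show "primary q q \<notin> {primary p q, secondary p q}" if "p < 6" "q \<in> targets p" "q \<le> p" for p q
      using table_targets[rule_format, OF that(1,2)] that(3) by blast
  qed blast+
  have bounds: "cnt v (sure (\<pi> v) i) \<le> colour_degree N c i v"
    "colour_degree N c i v \<le> cnt v (possible (\<pi> v) i)" if "v \<in> V" for v i
  proof -
    have c': "c v w \<in> {primary (\<pi> v) (\<pi> w), secondary (\<pi> v) (\<pi> w)}" if "w \<in> N v" for w
      using c[OF \<open>v \<in> V\<close>, of w] NV that by blast
    have "{w\<in>N v. \<pi> w \<in> sure (\<pi> v) i} = {w \<in> N v. primary (\<pi> v) (\<pi> w) = i \<and> secondary (\<pi> v) (\<pi> w) = i}"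
      "{w\<in>N v. \<pi> w \<in> possible (\<pi> v) i} = {w \<in> N v. primary (\<pi> v) (\<pi> w) = i \<or> secondary (\<pi> v) (\<pi> w) = i}"
      using \<pi> NV by (auto simp: sure_def possible_def)
    then show "cnt v (sure (\<pi> v) i) \<le> colour_degree N c i v"
      "colour_degree N c i v \<le> cnt v (possible (\<pi> v) i)"
      using colour_degree_bounds[where N = N and c = c and \<pi> = \<pi> and \<alpha> = primary and \<beta> = secondary,
          OF finN c'] by (simp_all add: cnt_def)
  qed
  have irregular: "colour_degree N c (c u v) u \<noteq> colour_degree N c (c u v) v" if uv: "u \<in> V" "v \<in> N u" for u v
  proof (cases "\<pi> u = \<pi> v")
    case True
    \<comment> \<open>Inside a piece both tables agree, so the edge has the inner colour and the
      greedy choice applies.\<close>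
    have "v \<in> V"
      using uv NV by auto
    then have "c u v = primary (\<pi> u) (\<pi> u)"
      using c[OF uv(1), of v] True table_diagonal \<pi>[OF uv(1)] by auto
    then show ?thesis
      using internal[OF uv True] by simp
  next
    case False
    \<comment> \<open>Between pieces, the guaranteed degree at one end exceeds the largest possible
      degree at the other, independently of the greedy choices.\<close>
    define i where "i = c u v"
    have v: "v \<in> V"
      using uv NV by auto
    have "i \<in> {primary (\<pi> u) (\<pi> v), secondary (\<pi> u) (\<pi> v)}"
      unfolding i_def using c[OF uv(1) v] by blast
    then have "sum piece_weight (possible (\<pi> v) i) + 2 \<le> sum piece_weight (sure (\<pi> u) i) \<or>
        sum piece_weight (possible (\<pi> u) i) + 2 \<le> sum piece_weight (sure (\<pi> v) i)"
      by (rule table_separated[rule_format, OF \<pi>[OF uv(1)] \<pi>[OF v] False])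
    moreover have "sure p i \<subseteq> {..<6}" "possible p i \<subseteq> {..<6}" for p
      by (auto simp: sure_def possible_def)
    ultimately have "cnt v (possible (\<pi> v) i) < cnt u (sure (\<pi> u) i) \<or>
        cnt u (possible (\<pi> u) i) < cnt v (sure (\<pi> v) i)"
      using cnt_less[OF uv(1) v] cnt_less[OF v uv(1)] by meson
    then have "colour_degree N c i u \<noteq> colour_degree N c i v"
      using bounds[OF uv(1), of i] bounds[OF v, of i] by linarith
    then show ?thesis
      by (simp add: i_def)
  qed

  define Q where "Q i = {e \<in> E. \<exists>u v. e = {u, v} \<and> c u v = i}" for i
  \<comment> \<open>Symmetry of \<open>c\<close> on \<open>V\<close> makes the class of an edge
    independent of the orientation chosen in \<open>Q\<close>.\<close>
  have Q: "{u, v} \<in> Q i \<longleftrightarrow> v \<in> N u \<and> c u v = i" for u v i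
  proof (cases "{u, v} \<in> E")
    case True
    then have "c u v = c v u"
      using c[of u v] E[of "{u, v}"] by auto
    then show ?thesis
      using True by (auto simp: Q_def N_def doubleton_eq_iff)
  qed (auto simp: Q_def N_def)
  have Q_degree: "graph_degree (Q i) v = colour_degree N c i v" for i v
  proof -
    have "Q i \<subseteq> E"
      by (auto simp: Q_def)
    then show ?thesis
      by (simp add: graph_degree Q colour_degree_def)
  qed
  have edge: "\<exists>u v. e = {u, v} \<and> u \<in> V \<and> v \<in> V" if "e \<in> E" for e
    using E[OF that] by (auto simp: card_2_iff)
  have "disjoint_family_on Q {1..4}"
    unfolding disjoint_family_on_def
  proof (intro ballI impI equals0I)
    fix i j e assume "i \<noteq> j" "e \<in> Q i \<inter> Q j"
    moreover from this obtain u v where "e = {u, v}"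
      using edge[of e] by (auto simp: Q_def)
    ultimately show False
      using Q by auto
  qed
  moreover have "(\<Union>i\<in>{1..4}. Q i) = E"
  proof (intro equalityI subsetI)
    fix e assume e: "e \<in> E"
    then obtain u v where uv: "e = {u, v}" "u \<in> V" "v \<in> V"
      using edge by blast
    have "c u v \<in> {1..4}"
      using c[OF uv(2,3)] table_colours[rule_format, OF \<pi>[OF uv(2)] \<pi>[OF uv(3)]] by auto
    moreover have "e \<in> Q (c u v)"
      using e uv(1) unfolding Q_def by (intro CollectI conjI exI[of _ u] exI[of _ v] refl) simp_all
    ultimately show "e \<in> (\<Union>i\<in>{1..4}. Q i)"
      by (rule UN_I)
  qed (auto simp: Q_def)
  moreover have "locally_irregular V (Q i)" for i
    unfolding locally_irregular_def simple_graph_def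
  proof (intro conjI ballI impI)
    fix u v assume "u \<in> V" "{u, v} \<in> Q i"
    then show "graph_degree (Q i) u \<noteq> graph_degree (Q i) v"
      using irregular[of u v] by (auto simp: Q Q_degree)
  qed (use V E in \<open>auto simp: Q_def\<close>)
  ultimately show ?thesis
    unfolding lir_decomposable_def by (intro exI[of _ Q] conjI ballI) simp_all
qed

end
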